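(* Let $\mathbb{F}$ be one of the following fields: $\mathbb{R}$; $\mathbb{Z}/p\mathbb{Z}$ for an odd prime $p$; $\mathbb{Q}$; or $\mathbb{Q}_p$ for a prime $p > 0$. Let $V, W$ be vector spaces over $\mathbb{F}$ with $\dim V \geqslant 2$. Suppose $f : V \to W$ is any map that takes affine lines onto affine lines (i.e., for every affine line $\ell \subseteq V$, the image $f(\ell)$ is an affine line in $W$), and such that $f(v) \notin f(\ell)$ whenever $\ell \subseteq V$ is an affine line and $v \in V \setminus \ell$. Then $f$ is affine-linear on $V$.
   Context: An affine line in a vector space $V$ over $\mathbb{F}$ is a subset of the form $v_0 + \mathbb{F} w = \{v_0 + \lambda w : \lambda \in \mathbb{F}\}$ with $v_0, w \in V$, $w \neq 0$. A map $f : V \to W$ of $\mathbb{F}$-vector spaces is affine-linear if it is the composite of an $\mathbb{F}$-linear map $V \to W$ and a translation in $W$. $\mathbb{Q}_p$ denotes the field of $p$-adic numbers. *)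

theory Defs
  imports
    Complex_Main
    "HOL-Computational_Algebra.Primes"
    "HOL-Number_Theory.Residues"
    "HOL-Algebra.QuotRing"
    "HOL-Algebra.Algebraic_Closure_Type"
begin

section \<open>The field of \<open>p\<close>-adic numbers\<close>

definition padic_val :: "nat \<Rightarrow> rat \<Rightarrow> int" where
  "padic_val p x =
     int (multiplicity (int p) (fst (quotient_of x)))
     - int (multiplicity (int p) (snd (quotient_of x)))"

definition padic_abs :: "nat \<Rightarrow> rat \<Rightarrow> real" where
  "padic_abs p x = (if x = 0 then 0 else real p powi (- padic_val p x))"

definition padic_Cauchy :: "nat \<Rightarrow> (nat \<Rightarrow> rat) \<Rightarrow> bool" where
  "padic_Cauchy p a \<longleftrightarrow>
     (\<forall>e>0. \<exists>N. \<forall>m\<ge>N. \<forall>n\<ge>N. padic_abs p (a m - a n) < e)"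

definition padic_Cauchy_ring :: "nat \<Rightarrow> (nat \<Rightarrow> rat) ring" where
  "padic_Cauchy_ring p =
     \<lparr>carrier = {a. padic_Cauchy p a},
      monoid.mult = (\<lambda>a b n. a n * b n), one = (\<lambda>_. 1),
      zero = (\<lambda>_. 0), add = (\<lambda>a b n. a n + b n)\<rparr>"

definition padic_null :: "nat \<Rightarrow> (nat \<Rightarrow> rat) set" where
  "padic_null p = {a. (\<lambda>n. padic_abs p (a n)) \<longlonglongrightarrow> 0}"

text \<open>The completion of the rationals for the \<open>p\<close>-adic absolute value: Cauchy sequences
  modulo null sequences. It is the field of \<open>p\<close>-adic numbers when \<open>p\<close> is prime.\<close>

definition Qp :: "nat \<Rightarrow> (nat \<Rightarrow> rat) set ring" where
  "Qp p = padic_Cauchy_ring p Quot padic_null p"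


section \<open>The admissible ground fields\<close>

text \<open>The fields in question have carriers of different types, and for \<open>\<int>/p\<int>\<close> and the \<open>p\<close>-adic
  numbers the carrier depends on a number \<open>p\<close>. The ground field is therefore a type of class
  \<open>field\<close>, required to be isomorphic, as a ring, to one of them.\<close>

definition admissible_field :: "'k::field itself \<Rightarrow> bool" where
  "admissible_field T \<longleftrightarrow>
     (ring_of_type_algebra :: 'k ring) \<simeq> (ring_of_type_algebra :: real ring) \<or>
     (\<exists>p::nat. Factorial_Ring.prime p \<and> odd p \<and> (ring_of_type_algebra :: 'k ring) \<simeq> residue_ring (int p)) \<or>
     (ring_of_type_algebra :: 'k ring) \<simeq> (ring_of_type_algebra :: rat ring) \<or>
     (\<exists>p::nat. Factorial_Ring.prime p \<and> (ring_of_type_algebra :: 'k ring) \<simeq> Qp p)"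


section \<open>Vector spaces, affine lines and affine-linear maps\<close>

text \<open>The constant \<open>vector_space.dim\<close> is a natural number and carries no information for
  infinite-dimensional spaces, which are allowed here.\<close>

definition dim_at_least :: "nat \<Rightarrow> ('k::field \<Rightarrow> 'v::ab_group_add \<Rightarrow> 'v) \<Rightarrow> bool" where
  "dim_at_least n scale \<longleftrightarrow>
     (\<exists>B. \<not> module.dependent scale B \<and> module.span scale B = UNIV \<and>
          (infinite B \<or> n \<le> card B))"

definition affine_line :: "('k::field \<Rightarrow> 'v::ab_group_add \<Rightarrow> 'v) \<Rightarrow> 'v set \<Rightarrow> bool" where
  "affine_line scale l \<longleftrightarrow> (\<exists>v0 w. w \<noteq> 0 \<and> l = {v0 + scale c w |c. True})"

definition affine_linear ::
  "('k::field \<Rightarrow> 'v::ab_group_add \<Rightarrow> 'v) \<Rightarrow> ('k \<Rightarrow> 'w::ab_group_add \<Rightarrow> 'w) \<Rightarrow>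
     ('v \<Rightarrow> 'w) \<Rightarrow> bool" where
  "affine_linear scaleV scaleW f \<longleftrightarrow>
     (\<exists>g b. Vector_Spaces.linear scaleV scaleW g \<and> f = (\<lambda>w. w + b) \<circ> g)"

end

theory Submission
  imports Defs
begin

text \<open>After a translation \<open>f 0 = 0\<close>. For independent \<open>u, v\<close> the diagonals of the parallelogram
  \<open>0, u, u + v, v\<close> meet, since \<open>2 \<noteq> 0\<close>, so its image lies in the plane spanned by \<open>f u, f v\<close>; the
  images of opposite sides are disjoint lines of that plane, hence parallel, and
  \<open>f (u + v) = f u + f v\<close>. It follows as in the fundamental theorem of affine geometry that \<open>f\<close> is
  additive and \<open>f (c v) = \<sigma> c f v\<close> for a ring endomorphism \<open>\<sigma>\<close> of the ground field. All admissible
  fields have no endomorphism except the identity. For \<open>\<rat>\<^sub>p\<close> the reason is that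
  \<open>\<int>\<^sub>p = {x. \<exists>w. w\<^sup>2 + w = p x\<^sup>2}\<close> is preserved by \<open>\<sigma>\<close>, so \<open>\<sigma>\<close> is continuous, and it fixes \<open>\<rat>\<close>.\<close>

section \<open>Unital ring homomorphisms\<close>

definition unital_hom :: "('a::ring_1 \<Rightarrow> 'b::ring_1) \<Rightarrow> bool" where
  "unital_hom h \<longleftrightarrow> h 1 = 1 \<and> (\<forall>x y. h (x + y) = h x + h y) \<and> (\<forall>x y. h (x * y) = h x * h y)"

lemma unital_homD:
  assumes "unital_hom h"
  shows "h 1 = 1" "h (x + y) = h x + h y" "h (x * y) = h x * h y"
  using assms unfolding unital_hom_def by blast+

lemma unital_hom_0: "unital_hom h \<Longrightarrow> h 0 = 0"
  using unital_homD(2)[of h 0 0] by simp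

lemma unital_hom_uminus: "unital_hom h \<Longrightarrow> h (- x) = - h x"
  using unital_homD(2)[of h x "- x"] unital_hom_0[of h] by (simp add: eq_neg_iff_add_eq_0 add.commute)

lemma unital_hom_diff: "unital_hom h \<Longrightarrow> h (x - y) = h x - h y"
  using unital_homD(2)[of h x "- y"] unital_hom_uminus[of h y] by simp

lemma unital_hom_of_nat: "unital_hom h \<Longrightarrow> h (of_nat n) = of_nat n"
  by (induction n) (simp_all add: unital_hom_0 unital_homD)

lemma unital_hom_of_int: "unital_hom h \<Longrightarrow> h (of_int z) = of_int z"
  by (cases z rule: int_cases2) (simp_all add: unital_hom_uminus unital_hom_of_nat)

lemma rat_as_quotient:
  fixes x :: rat
  obtains a b where "b \<noteq> 0" "x = of_int a / of_int b"
proof -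
  obtain c d where cd: "quotient_of x = (c, d)" by fastforce
  show ?thesis using that[of d c] quotient_of_denom_pos[OF cd] quotient_of_div[OF cd] by simp
qed

lemma unital_hom_rat_unique:
  fixes h g :: "rat \<Rightarrow> 'a::field"
  assumes h: "unital_hom h" and g: "unital_hom g"
  shows "h = g"
proof
  fix x :: rat
  obtain a b where ab: "b \<noteq> 0" "x = of_int a / of_int b"
    using rat_as_quotient .
  have eq: "x * of_int b = of_int a" using ab by simp
  \<comment> \<open>The image of the denominator is a unit, so it can be cancelled and the value at
    \<open>x\<close> is determined by values at integers.\<close>
  have "h (of_int b) * h (1 / of_int b) = 1"
    using ab unital_homD(3)[OF h, of "of_int b" "1 / of_int b"] unital_homD(1)[OF h] by simp
  then have nz: "(of_int b :: 'a) \<noteq> 0" by (auto simp: unital_hom_of_int[OF h])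
  have "h x * of_int b = g x * of_int b"
    using unital_homD(3)[OF h, of x "of_int b"] unital_homD(3)[OF g, of x "of_int b"]
    by (simp add: eq unital_hom_of_int h g)
  then show "h x = g x" using nz by simp
qed

lemma unital_hom_comp: "unital_hom h \<Longrightarrow> unital_hom g \<Longrightarrow> unital_hom (h \<circ> g)"
  unfolding unital_hom_def by simp

lemma unital_hom_inv:
  assumes h: "unital_hom h" and bij: "bij h"
  shows "unital_hom (inv_into UNIV h)"
  using assms by (auto simp: unital_hom_def bij_is_inj bij_is_surj surj_f_inv_f
      intro!: inv_f_eq)

lemma unital_hom_two_neq_0:
  assumes "unital_hom (h :: 'a::ring_1 \<Rightarrow> 'b::ring_char_0)"
  shows "(2::'a) \<noteq> 0"
  using unital_hom_of_nat[OF assms, of 2] unital_hom_0[OF assms] by auto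

section \<open>Maps preserving lines are semilinear\<close>

lemma (in vector_space) eq_scale_of_add_eq_0:
  assumes "scale a u + scale b v = 0" "b \<noteq> 0"
  shows "v = scale (- a / b) u"
proof -
  have 1: "scale b v = scale (- a) u"
    using assms(1) by (simp add: eq_neg_iff_add_eq_0 add.commute)
  have "v = scale (1 / b) (scale b v)" using assms(2) by simp
  also have "\<dots> = scale (- a / b) u" by (simp add: 1)
  finally show ?thesis .
qed

text \<open>Of the ground field only \<open>2 \<noteq> 0\<close> is assumed, so the most one can
  reach here is semilinearity. With \<open>f 0 = 0\<close>, lines through the origin go to lines
  through the origin.\<close>

locale line_embedding = V: vector_space scaleV + W: vector_space scaleW
  for scaleV :: "'k::field \<Rightarrow> 'v::ab_group_add \<Rightarrow> 'v" (infixr \<open>*a\<close> 75)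
    and scaleW :: "'k \<Rightarrow> 'w::ab_group_add \<Rightarrow> 'w" (infixr \<open>*b\<close> 75) +
  fixes f :: "'v \<Rightarrow> 'w"
  assumes two_neq_0: "(2::'k) \<noteq> 0"
    and dim_ge_2: "dim_at_least 2 scaleV"
    and image_line: "\<And>l. affine_line scaleV l \<Longrightarrow> affine_line scaleW (f ` l)"
    and off_line: "\<And>l v. affine_line scaleV l \<Longrightarrow> v \<notin> l \<Longrightarrow> f v \<notin> f ` l"
    and f_0: "f 0 = 0"
begin

text \<open>Stated for pairs, not for the set \<open>{u, v}\<close>: that set collapses to a
  singleton when \<open>u = v\<close>, whereas \<open>indep u u\<close> is always false.\<close>

definition indep :: "'v \<Rightarrow> 'v \<Rightarrow> bool" where
  "indep u v \<longleftrightarrow> (\<forall>c d. c *a u + d *a v = 0 \<longrightarrow> c = 0 \<and> d = 0)"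

lemma indepD: "indep u v \<Longrightarrow> c *a u + d *a v = 0 \<Longrightarrow> c = 0 \<and> d = 0"
  unfolding indep_def by blast

lemma indep_sym: "indep u v \<Longrightarrow> indep v u"
  unfolding indep_def by (metis add.commute)

lemma indep_nonzero: "indep u v \<Longrightarrow> u \<noteq> 0"
  using indepD[of u v 1 0] by auto

lemma indep_neq_scale: "indep u v \<Longrightarrow> v \<noteq> c *a u"
  using indepD[of u v c "-1"] by auto

lemma ex_indep:
  assumes "u \<noteq> 0"
  obtains v where "indep u v"
proof -
  obtain B where B: "\<not> V.dependent B" "infinite B \<or> 2 \<le> card B"
    using dim_ge_2 unfolding dim_at_least_def by blast
  \<comment> \<open>An independent set inside the span of a single vector has at most one
    element.\<close>
  have "\<not> B \<subseteq> V.span {u}"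
    using V.independent_span_bound[of "{u}" B] B by auto
  then obtain v where v: "v \<notin> V.span {u}" by blast
  have "indep u v"
    unfolding indep_def
  proof (intro allI impI)
    fix c d assume eq: "c *a u + d *a v = 0"
    have "d = 0"
    proof (rule ccontr)
      assume "d \<noteq> 0"
      have "v = (- c / d) *a u" using V.eq_scale_of_add_eq_0[OF eq \<open>d \<noteq> 0\<close>] .
      then show False
        using v unfolding V.span_singleton by blast
    qed
    then show "c = 0 \<and> d = 0" using eq assms by auto
  qed
  then show ?thesis by (rule that)
qed

section \<open>Injectivity and images of lines\<close>

lemma inj: "inj f"
proof (rule injI, rule ccontr)
  fix x y assume eq: "f x = f y" and neq: "x \<noteq> y"
  \<comment> \<open>The line through \<open>x\<close> in a direction independent of
    \<open>y - x\<close> misses \<open>y\<close>, yet its image contains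
    \<open>f x = f y\<close>.\<close>
  obtain w where w: "indep (y - x) w" using ex_indep[of "y - x"] neq by auto
  let ?l = "{x + c *a w |c. True}"
  have "affine_line scaleV ?l"
    using indep_nonzero[OF indep_sym[OF w]] unfolding affine_line_def by blast
  moreover have "y \<notin> ?l"
    using indep_neq_scale[OF indep_sym[OF w]] by (auto simp: algebra_simps)
  moreover have "x \<in> ?l" by (auto intro!: exI[of _ 0])
  ultimately show False using off_line eq by (metis imageI)
qed

text \<open>By injectivity the image line has two distinct points \<open>f x\<close> and
  \<open>f (x + w)\<close>, so it is the line joining them.\<close>

lemma image_line_eq:
  assumes "w \<noteq> 0"
  shows "f ` {x + c *a w |c. True} = {f x + c *b (f (x + w) - f x) |c. True}"
proof -
  let ?l = "{x + c *a w |c. True}"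
  obtain a b where b: "b \<noteq> 0" and l: "f ` ?l = {a + c *b b |c. True}"
    using image_line[of ?l] assms unfolding affine_line_def by blast
  have "x \<in> ?l" "x + w \<in> ?l" by (auto intro!: exI[of _ 0] exI[of _ 1])
  then have "f x \<in> f ` ?l" "f (x + w) \<in> f ` ?l" by blast+
  then obtain r s where r: "f x = a + r *b b" and s: "f (x + w) = a + s *b b"
    unfolding l by blast
  have "r \<noteq> s"
    using injD[OF inj, of x "x + w"] r s assms by auto
  then have rs: "s - r \<noteq> 0" by simp
  have diff: "f (x + w) - f x = (s - r) *b b"
    unfolding r s by (simp add: algebra_simps)
  \<comment> \<open>Change of parameter: \<open>r\<close> and \<open>s\<close> are the positions of
    \<open>f x\<close> and \<open>f (x + w)\<close> on the line \<open>a + c *b b\<close>.\<close>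
  have "a + c *b b = f x + ((c - r) / (s - r)) *b (f (x + w) - f x)" for c
  proof -
    have "((c - r) / (s - r)) *b (s - r) *b b = (c - r) *b b" using rs by simp
    then show ?thesis unfolding diff by (simp only: r) (simp add: W.scale_left_diff_distrib)
  qed
  moreover have "f x + c *b (f (x + w) - f x) = a + (r + c * (s - r)) *b b" for c
    unfolding diff by (simp add: r W.scale_left_distrib)
  ultimately show ?thesis unfolding l by blast
qed

lemma image_point: "\<exists>d. f (x + c *a w) = f x + d *b (f (x + w) - f x)"
proof (cases "w = 0")
  case True
  then show ?thesis by simp
next
  case False
  then show ?thesis using image_line_eq[OF False, of x] by blast
qed

lemma preimage_point: "\<exists>c. f x + d *b (f (x + w) - f x) = f (x + c *a w)"
proof (cases "w = 0")
  case True
  then show ?thesis by simp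
next
  case False
  then show ?thesis using image_line_eq[OF False, of x] by blast
qed

lemma image_scale: "\<exists>d. f (c *a w) = d *b f w"
  using image_point[of 0 c w] f_0 by simp

lemma preimage_scale: "\<exists>c. d *b f w = f (c *a w)"
  using preimage_point[of 0 d w] f_0 by simp

text \<open>A multiple of \<open>f u\<close> is itself a value of \<open>f\<close> at a multiple of
  \<open>u\<close>, so by injectivity a dependence of the images would make \<open>v\<close> a
  multiple of \<open>u\<close>.\<close>

lemma f_indep:
  assumes "indep u v" and eq: "c *b f u + d *b f v = 0"
  shows "c = 0 \<and> d = 0"
proof -
  have "d = 0"
  proof (rule ccontr)
    assume "d \<noteq> 0"
    have "f v = (- c / d) *b f u" using W.eq_scale_of_add_eq_0[OF eq \<open>d \<noteq> 0\<close>] .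
    then obtain e where "f v = f (e *a u)" using preimage_scale by metis
    then show False
      using injD[OF inj] indep_neq_scale[OF assms(1)] by blast
  qed
  moreover have "f u \<noteq> 0"
    using injD[OF inj, of u 0] f_0 indep_nonzero[OF assms(1)] by auto
  ultimately show ?thesis using eq by auto
qed

lemma f_indep_unique:
  assumes "indep u v" and "a *b f u + b *b f v = c *b f u + d *b f v"
  shows "a = c \<and> b = d"
proof -
  have "(a - c) *b f u + (b - d) *b f v = 0"
    using assms(2) by (simp add: algebra_simps)
  then show ?thesis using f_indep[OF assms(1)] by force
qed

section \<open>Additivity on independent pairs\<close>

lemma f_add_indep_coeff:
  assumes uv: "indep u v"
  obtains a where "f (u + v) = a *b f u + f v"
proof -
  \<comment> \<open>The common midpoint of the two diagonals. Lying on the diagonal from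
    \<open>u\<close> to \<open>v\<close>, it is mapped into the plane spanned by \<open>f u\<close>
    and \<open>f v\<close>.\<close>
  define m where "m = (1/2) *a (u + v)"
  obtain t where "f (u + (1/2) *a (v - u)) = f u + t *b (f (u + (v - u)) - f u)"
    using image_point by blast
  moreover have "u + (1/2) *a (v - u) = m"
  proof -
    have "(1/2 + 1/2 :: 'k) = 1" using two_neq_0 by (simp add: field_simps)
    then have "(1/2) *a u + (1/2) *a u = u" by (metis V.scale_left_distrib V.scale_one)
    then show ?thesis unfolding m_def by (simp add: algebra_simps)
  qed
  ultimately have t: "f m = f u + t *b (f v - f u)" by simp
  \<comment> \<open>The point \<open>m\<close> also lies on the diagonal through \<open>0\<close>
    and \<open>u + v\<close>, so \<open>f (u + v)\<close> is a multiple of \<open>f m\<close> and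
    stays in that plane.\<close>
  have "(2::'k) *a m = u + v"
    unfolding m_def using two_neq_0 by simp
  then obtain s where "f (u + v) = s *b f m" using image_scale by metis
  then have "f (u + v) = (s - s * t) *b f u + (s * t) *b f v"
    unfolding t by (simp add: algebra_simps)
  then obtain a b where ab: "f (u + v) = a *b f u + b *b f v" by blast
  \<comment> \<open>Otherwise the line through \<open>f v\<close> and \<open>f (v + u)\<close> meets
    the line through \<open>0\<close> and \<open>f u\<close>. These are the images of two parallel
    lines in direction \<open>u\<close>, which are disjoint.\<close>
  have "b = 1"
  proof (rule ccontr)
    assume "b \<noteq> 1"
    \<comment> \<open>The parameter at which the coefficient of \<open>f v\<close> vanishes, that
      is, the intersection point.\<close>
    define r where "r = - 1 / (b - 1)"
    have "f v + r *b (f (v + u) - f v) = (r * a) *b f u + (1 + r * (b - 1)) *b f v"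
      unfolding add.commute[of v u] ab by (simp add: algebra_simps)
    also have "1 + r * (b - 1) = 0"
      using \<open>b \<noteq> 1\<close> unfolding r_def by simp
    finally have "f v + r *b (f (v + u) - f v) = (r * a) *b f u" by simp
    then obtain c d where "f (v + c *a u) = f (d *a u)"
      by (metis preimage_point preimage_scale)
    then have "v + c *a u = d *a u" using injD[OF inj] by blast
    then have "(c - d) *a u + 1 *a v = 0" by (simp add: algebra_simps)
    from indepD[OF uv this] show False by simp
  qed
  with ab have "f (u + v) = a *b f u + f v" by simp
  then show ?thesis by (rule that)
qed

text \<open>The preceding argument fixes one coefficient of \<open>f (u + v)\<close>. Exchanging
  \<open>u\<close> and \<open>v\<close> fixes the other.\<close>

lemma f_add_indep:
  assumes uv: "indep u v"
  shows "f (u + v) = f u + f v"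
proof -
  obtain a where a: "f (u + v) = a *b f u + f v" using f_add_indep_coeff[OF uv] .
  obtain b where b: "f (v + u) = b *b f v + f u" using f_add_indep_coeff[OF indep_sym[OF uv]] .
  have "a *b f u + 1 *b f v = 1 *b f u + b *b f v"
    using a b by (simp add: add.commute)
  from f_indep_unique[OF uv this] a show ?thesis by simp
qed

section \<open>The scalar map\<close>

definition coeff :: "'v \<Rightarrow> 'k \<Rightarrow> 'k" where
  "coeff v c = (SOME d. f (c *a v) = d *b f v)"

lemma f_scale_coeff: "f (c *a v) = coeff v c *b f v"
  unfolding coeff_def using someI_ex[OF image_scale] .

lemma indep_scale:
  assumes "indep u v" "c \<noteq> 0"
  shows "indep (c *a u) v"
  unfolding indep_def
proof (intro allI impI)
  fix a b assume "a *a c *a u + b *a v = 0"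
  then show "a = 0 \<and> b = 0" using indepD[OF assms(1), of "a * c" b] assms(2) by simp
qed

lemma f_add_scale_indep:
  assumes uv: "indep u v"
  shows "f (c *a u + d *a v) = f (c *a u) + f (d *a v)"
proof (cases "c = 0 \<or> d = 0")
  case True
  then show ?thesis using f_0 by auto
next
  case False
  then show ?thesis
    by (intro f_add_indep indep_sym[OF indep_scale] indep_scale uv) auto
qed

text \<open>Expanding \<open>f (c *a (u + v))\<close> in two ways and comparing coefficients shows
  that both sides equal \<open>coeff (u + v) c\<close>.\<close>

lemma coeff_eq_indep:
  assumes uv: "indep u v"
  shows "coeff u c = coeff v c"
proof -
  have "coeff (u + v) c *b f u + coeff (u + v) c *b f v = f (c *a (u + v))"
    by (simp add: f_scale_coeff f_add_indep[OF uv] W.scale_right_distrib)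
  also have "\<dots> = coeff u c *b f u + coeff v c *b f v"
    by (simp add: V.scale_right_distrib f_add_scale_indep[OF uv] f_scale_coeff)
  finally show ?thesis using f_indep_unique[OF uv] by metis
qed

text \<open>Dependent vectors are compared through a third one independent of both. Zero is excluded
  because every scalar meets the condition defining \<open>coeff 0 c\<close>, so its value is an
  arbitrary choice.\<close>

lemma coeff_eq:
  assumes "u \<noteq> 0" "v \<noteq> 0"
  shows "coeff u c = coeff v c"
proof (cases "indep u v")
  case True
  then show ?thesis by (rule coeff_eq_indep)
next
  case False
  then obtain a b where ab: "a *a u + b *a v = 0" "a \<noteq> 0 \<or> b \<noteq> 0"
    unfolding indep_def by blast
  with assms have "a \<noteq> 0" "b \<noteq> 0" by auto
  obtain w where w: "indep u w" using ex_indep assms by blast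
  have v: "v = (- a / b) *a u" using V.eq_scale_of_add_eq_0[OF ab(1) \<open>b \<noteq> 0\<close>] .
  have "indep v w" unfolding v using \<open>a \<noteq> 0\<close> \<open>b \<noteq> 0\<close> by (intro indep_scale w) auto
  then show ?thesis using w coeff_eq_indep by metis
qed

theorem semilinear:
  shows "\<exists>\<sigma>. unital_hom \<sigma> \<and> (\<forall>c v. f (c *a v) = \<sigma> c *b f v) \<and> (\<forall>u v. f (u + v) = f u + f v)"
proof -
  obtain B where B: "\<not> V.dependent B" "infinite B \<or> 2 \<le> card B"
    using dim_ge_2 unfolding dim_at_least_def by blast
  have "B \<noteq> {}" using B(2) by auto
  then obtain e where "e \<in> B" by blast
  then have e: "e \<noteq> 0" using B(1) V.dependent_zero by metis
  define \<sigma> where "\<sigma> = coeff e"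
  have scale: "f (c *a v) = \<sigma> c *b f v" for c v
  proof (cases "v = 0")
    case True
    then show ?thesis using f_0 by simp
  next
    case False
    then show ?thesis using f_scale_coeff[of c v] coeff_eq[OF False e, of c] \<sigma>_def by simp
  qed
  have nz: "f e \<noteq> 0" using injD[OF inj, of e 0] f_0 e by auto
  \<comment> \<open>Additivity along one line is obtained by leaving it: with \<open>w\<close>
    independent of \<open>u\<close>, the sum \<open>c *a u + (d *a u + w)\<close> involves only
    independent pairs or zero summands, and \<open>f w\<close> cancels at the end.\<close>
  have multiple: "f (c *a u + d *a u) = f (c *a u) + f (d *a u)" if u: "u \<noteq> 0" for c d u
  proof -
    obtain w where w: "indep u w" using ex_indep u by blast
    have "f ((c + d) *a u) + f w = f ((c + d) *a u + 1 *a w)"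
      using f_add_scale_indep[OF w, of "c + d" 1] by simp
    also have "\<dots> = f (c *a u + (d *a u + w))"
      by (simp add: algebra_simps)
    also have "\<dots> = f (c *a u) + f (d *a u + w)"
    proof (cases "c = 0")
      case True
      then show ?thesis using f_0 by simp
    next
      case False
      have "indep u (d *a u + w)"
        unfolding indep_def
      proof (intro allI impI)
        fix a b assume "a *a u + b *a (d *a u + w) = 0"
        then have "(a + b * d) *a u + b *a w = 0" by (simp add: algebra_simps)
        then show "a = 0 \<and> b = 0" using indepD[OF w] by fastforce
      qed
      then show ?thesis using False by (intro f_add_indep indep_scale)
    qed
    also have "f (d *a u + w) = f (d *a u) + f w"
      using f_add_scale_indep[OF w, of d 1] by simp
    finally show ?thesis by (simp add: V.scale_left_distrib)
  qed
  have "\<sigma> 1 *b f e = 1 *b f e" using scale[of 1 e] by simp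
  then have 1: "\<sigma> 1 = 1" using nz by (metis W.scale_right_imp_eq)
  have 2: "\<sigma> (c + d) = \<sigma> c + \<sigma> d" for c d
  proof -
    have "\<sigma> (c + d) *b f e = (\<sigma> c + \<sigma> d) *b f e"
      using multiple[OF e, of c d] by (simp add: scale W.scale_left_distrib flip: V.scale_left_distrib)
    then show ?thesis using nz by (metis W.scale_right_imp_eq)
  qed
  have 3: "\<sigma> (c * d) = \<sigma> c * \<sigma> d" for c d
  proof -
    have "\<sigma> (c * d) *b f e = (\<sigma> c * \<sigma> d) *b f e"
      by (metis scale V.scale_scale W.scale_scale)
    then show ?thesis using nz by (metis W.scale_right_imp_eq)
  qed
  have "f (u + v) = f u + f v" for u v
  proof (cases "u = 0 \<or> indep u v")
    case True
    then show ?thesis using f_add_indep f_0 by auto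
  next
    case False
    then obtain a b where ab: "a *a u + b *a v = 0" "a \<noteq> 0 \<or> b \<noteq> 0" "u \<noteq> 0"
      unfolding indep_def by blast
    then have "b \<noteq> 0" by auto
    have "v = (- a / b) *a u" using V.eq_scale_of_add_eq_0[OF ab(1) \<open>b \<noteq> 0\<close>] .
    then show ?thesis using multiple[OF \<open>u \<noteq> 0\<close>, of 1 "- a / b"] by simp
  qed
  with 1 2 3 scale show ?thesis by (intro exI[of _ \<sigma>]) (auto simp: unital_hom_def)
qed

end

section \<open>Fields without nontrivial endomorphisms\<close>

definition rigid :: "'k::field itself \<Rightarrow> bool" where
  "rigid T \<longleftrightarrow> (\<forall>\<sigma> :: 'k \<Rightarrow> 'k. unital_hom \<sigma> \<longrightarrow> (\<forall>x. \<sigma> x = x))"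

text \<open>Conjugation by \<open>h\<close> turns an endomorphism of \<open>'a\<close> into one of
  \<open>'b\<close>.\<close>

lemma rigid_transfer:
  fixes h :: "'a::field \<Rightarrow> 'b::field"
  assumes h: "unital_hom h" "bij h" and rigid: "rigid TYPE('b)"
  shows "rigid TYPE('a)"
  unfolding rigid_def
proof (intro allI impI)
  fix \<sigma> :: "'a \<Rightarrow> 'a" and x
  assume "unital_hom \<sigma>"
  then have "unital_hom (h \<circ> \<sigma> \<circ> inv_into UNIV h)"
    by (intro unital_hom_comp unital_hom_inv h)
  then have "(h \<circ> \<sigma> \<circ> inv_into UNIV h) (h x) = h x" using rigid unfolding rigid_def by blast
  then show "\<sigma> x = x" using h(2) by (simp add: bij_is_inj inj_eq)
qed

lemma rigid_rat: "rigid TYPE(rat)"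
proof -
  have "unital_hom (id :: rat \<Rightarrow> rat)" by (simp add: unital_hom_def)
  then show ?thesis unfolding rigid_def using unital_hom_rat_unique by (metis id_apply)
qed

text \<open>Nonnegative reals are squares, so \<open>\<sigma>\<close> is monotone; since it fixes
  the rationals, density leaves only the identity.\<close>

lemma rigid_real: "rigid TYPE(real)"
  unfolding rigid_def
proof (intro allI impI)
  fix \<sigma> :: "real \<Rightarrow> real" and x
  assume \<sigma>: "unital_hom \<sigma>"
  have "unital_hom (of_rat :: rat \<Rightarrow> real)" by (simp add: unital_hom_def of_rat_add of_rat_mult)
  from unital_hom_rat_unique[OF unital_hom_comp[OF \<sigma> this] this]
  have rat: "\<sigma> (of_rat q) = of_rat q" for q by (metis comp_apply)
  have nonneg: "\<sigma> y \<ge> 0" if "y \<ge> 0" for y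
    using unital_homD(3)[OF \<sigma>, of "sqrt y" "sqrt y"] that by simp
  have mono: "\<sigma> y \<le> \<sigma> z" if "y \<le> z" for y z
    using nonneg[of "z - y"] that by (simp add: unital_hom_diff[OF \<sigma>])
  show "\<sigma> x = x"
  proof (rule linorder_cases)
    assume "\<sigma> x < x"
    then obtain q where "\<sigma> x < of_rat q" "of_rat q < x" using of_rat_dense by blast
    then show ?thesis using mono[of "of_rat q" x] rat[of q] by simp
  next
    assume "x < \<sigma> x"
    then obtain q where "x < of_rat q" "of_rat q < \<sigma> x" using of_rat_dense by blast
    then show ?thesis using mono[of x "of_rat q"] rat[of q] by simp
  qed
qed

lemma ring_of_type_algebra_simps:
  fixes x y :: "'a::comm_ring_1"
  shows
  "carrier (ring_of_type_algebra :: 'a ring) = UNIV"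
  "x \<otimes>\<^bsub>(ring_of_type_algebra :: 'a ring)\<^esub> y = x * y"
  "x \<oplus>\<^bsub>(ring_of_type_algebra :: 'a ring)\<^esub> y = x + y"
  "\<one>\<^bsub>(ring_of_type_algebra :: 'a ring)\<^esub> = 1"
  by (simp_all add: ring_of_type_algebra_def)

lemma iso_type_algebra_imp_unital_hom:
  assumes "(ring_of_type_algebra :: 'a::comm_ring_1 ring) \<simeq> (ring_of_type_algebra :: 'b::comm_ring_1 ring)"
  shows "\<exists>h :: 'a \<Rightarrow> 'b. unital_hom h \<and> bij h"
proof -
  obtain h where "h \<in> ring_iso (ring_of_type_algebra :: 'a ring) (ring_of_type_algebra :: 'b ring)"
    using assms unfolding is_ring_iso_def by blast
  from ring_iso_memE[OF this] show ?thesis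
    by (intro exI[of _ h]) (auto simp: unital_hom_def ring_of_type_algebra_simps)
qed

lemma iso_residue_ring_rigid:
  assumes p: "Factorial_Ring.prime p" "odd p"
    and iso: "(ring_of_type_algebra :: 'k::field ring) \<simeq> residue_ring (int p)"
  shows "(2::'k) \<noteq> 0" "rigid TYPE('k)"
proof -
  have p2: "p > 2" using p prime_ge_2_nat[OF p(1)] by (metis even_numeral le_neq_implies_less)
  obtain h where h: "h \<in> ring_iso (ring_of_type_algebra :: 'k ring) (residue_ring (int p))"
    using iso unfolding is_ring_iso_def by blast
  note hs = ring_iso_memE[OF h, unfolded ring_of_type_algebra_simps]
  have range: "0 \<le> h x" "h x < int p" for x
    using hs(1)[of x] by (auto simp: residue_ring_def)
  have add: "h (x + y) = (h x + h y) mod int p" for x y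
    using hs(3)[of x y] by (simp add: residue_ring_def)
  have one: "h 1 = 1"
    using hs(4) by (simp add: residue_ring_def)
  \<comment> \<open>That \<open>h\<close> preserves zero is derived from additivity:
    \<open>p\<close> divides \<open>h 0\<close>, which lies between \<open>0\<close> and
    \<open>p - 1\<close>.\<close>
  have "h 0 = (h 0 + h 0) mod int p" using add[of 0 0] by simp
  then have "h 0 mod int p = (h 0 + h 0) mod int p" using range[of 0] by simp
  then have "int p dvd h 0" by (simp add: mod_eq_dvd_iff)
  then have zero: "h 0 = 0" using range[of 0] by (metis zdvd_not_zless le_less)
  have nat: "h (of_nat n) = int n mod int p" for n
    by (induction n) (simp_all add: zero one add mod_simps)
  show "(2::'k) \<noteq> 0" using nat[of 2] zero p2 by auto
  have inj: "inj h" using hs(5) by (simp add: bij_betw_def)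
  \<comment> \<open>Every element is a natural multiple of \<open>1\<close>, and such elements are
    fixed by any endomorphism.\<close>
  have of_nat: "x = of_nat (nat (h x))" for x
    using nat[of "nat (h x)"] range[of x] by (intro injD[OF inj]) simp
  show "rigid TYPE('k)"
    unfolding rigid_def using of_nat unital_hom_of_nat by metis
qed

section \<open>Rational sequences and the \<open>p\<close>-adic absolute value\<close>

locale padic =
  fixes p :: nat
  assumes prime_p: "Factorial_Ring.prime p"
begin

section \<open>Valuation and ultrametric absolute value\<close>

abbreviation nrm :: "rat \<Rightarrow> real" where
  "nrm \<equiv> padic_abs p"

lemma p_gt_1: "real p > 1"
  using prime_gt_1_nat[OF prime_p] by simp

text \<open>The definition refers to the reduced fraction. Cross-multiplication and additivity of
  the multiplicity of a prime allow any fraction.\<close>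

lemma val_quotient:
  assumes "a \<noteq> 0" "b \<noteq> 0"
  shows "padic_val p (of_int a / of_int b)
    = int (multiplicity (int p) a) - int (multiplicity (int p) b)"
proof -
  obtain c d where cd: "quotient_of (of_int a / of_int b) = (c, d)" by fastforce
  have d: "d \<noteq> 0" using quotient_of_denom_pos[OF cd] by simp
  have eq: "(of_int a / of_int b :: rat) = of_int c / of_int d" using quotient_of_div[OF cd] .
  then have c: "c \<noteq> 0" using assms d by auto
  have "(of_int (a * d) :: rat) = of_int (c * b)"
    using eq assms d by (simp add: field_simps)
  then have "a * d = c * b" by (simp only: of_int_eq_iff)
  then have "multiplicity (int p) (a * d) = multiplicity (int p) (c * b)" by simp
  moreover have "prime_elem (int p)" using prime_p by simp
  ultimately have "multiplicity (int p) a + multiplicity (int p) d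
      = multiplicity (int p) c + multiplicity (int p) b"
    using assms c d by (simp add: prime_elem_multiplicity_mult_distrib)
  then show ?thesis unfolding padic_val_def cd by simp
qed

lemma val_mult:
  assumes "x \<noteq> 0" "y \<noteq> 0"
  shows "padic_val p (x * y) = padic_val p x + padic_val p y"
proof -
  obtain a b where ab: "b \<noteq> 0" "x = of_int a / of_int b" using rat_as_quotient .
  obtain c d where cd: "d \<noteq> 0" "y = of_int c / of_int d" using rat_as_quotient .
  have nz: "a \<noteq> 0" "c \<noteq> 0" using ab cd assms by auto
  have "x * y = of_int (a * c) / of_int (b * d)" using ab cd by simp
  then have "padic_val p (x * y) =
      int (multiplicity (int p) (a * c)) - int (multiplicity (int p) (b * d))"
    using val_quotient[of "a * c" "b * d"] ab cd nz by simp
  moreover have "prime_elem (int p)" using prime_p by simp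
  ultimately show ?thesis
    using ab cd nz by (simp add: val_quotient prime_elem_multiplicity_mult_distrib)
qed

text \<open>Over a common denominator this is the fact that a power of \<open>p\<close> dividing two
  integers divides their sum. The sum must be nonzero, as \<open>padic_val p 0\<close> is
  \<open>0\<close> by default and not infinite.\<close>

lemma val_add:
  assumes "x \<noteq> 0" "y \<noteq> 0" "x + y \<noteq> 0"
  shows "min (padic_val p x) (padic_val p y) \<le> padic_val p (x + y)"
proof -
  obtain a0 b where ab: "b \<noteq> 0" "x = of_int a0 / of_int b" using rat_as_quotient .
  obtain c0 d where cd: "d \<noteq> 0" "y = of_int c0 / of_int d" using rat_as_quotient .
  define a c e where "a = a0 * d" and "c = c0 * b" and "e = b * d"
  have e: "e \<noteq> 0" using ab cd by (simp add: e_def)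
  have x: "x = of_int a / of_int e" and y: "y = of_int c / of_int e"
    using ab cd by (simp_all add: a_def c_def e_def)
  have xy: "x + y = of_int (a + c) / of_int e"
    unfolding x y by (simp add: add_divide_distrib)
  have nz: "a \<noteq> 0" "c \<noteq> 0" "a + c \<noteq> 0"
    using assms unfolding x y xy[unfolded x y] by auto
  have not_unit: "\<not> is_unit (int p)" using prime_p by (metis not_prime_unit prime_nat_int_transfer)
  have "int p ^ min (multiplicity (int p) a) (multiplicity (int p) c) dvd a + c"
    by (intro dvd_add multiplicity_dvd') auto
  then have "min (multiplicity (int p) a) (multiplicity (int p) c) \<le> multiplicity (int p) (a + c)"
    by (intro multiplicity_geI nz not_unit)
  then show ?thesis
    unfolding xy unfolding x y val_quotient[OF nz(1) e] val_quotient[OF nz(2) e]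
      val_quotient[OF nz(3) e] by linarith
qed

lemma nrm_0 [simp]: "nrm 0 = 0"
  by (simp add: padic_abs_def)

lemma nrm_nonneg [simp]: "nrm x \<ge> 0"
  by (simp add: padic_abs_def)

lemma nrm_eq_0_iff [simp]: "nrm x = 0 \<longleftrightarrow> x = 0"
  using p_gt_1 by (simp add: padic_abs_def)

lemma nrm_mult: "nrm (x * y) = nrm x * nrm y"
  using p_gt_1 by (auto simp: padic_abs_def val_mult simp flip: power_int_add)

lemma nrm_1 [simp]: "nrm 1 = 1"
  using val_quotient[of 1 1] by (simp add: padic_abs_def)

lemma nrm_uminus [simp]: "nrm (- x) = nrm x"
proof -
  have "nrm (-1) * nrm (-1) = 1" using nrm_mult[of "-1" "-1"] by simp
  then have "nrm (-1) = 1"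
    using nrm_nonneg[of "-1"] by (simp add: square_eq_1_iff)
  then show ?thesis using nrm_mult[of "-1" x] by simp
qed

lemma nrm_minus_commute: "nrm (x - y) = nrm (y - x)"
  using nrm_uminus[of "x - y"] by simp

lemma nrm_add: "nrm (x + y) \<le> max (nrm x) (nrm y)"
proof (cases "x = 0 \<or> y = 0 \<or> x + y = 0")
  case True
  then show ?thesis by (auto simp: le_max_iff_disj)
next
  case False
  then have "- padic_val p (x + y) \<le> - padic_val p x \<or> - padic_val p (x + y) \<le> - padic_val p y"
    using val_add[of x y] by auto
  then show ?thesis
    using False p_gt_1 power_int_increasing[of _ _ "real p"]
    by (auto simp: padic_abs_def le_max_iff_disj)
qed

lemma nrm_add_le: "nrm x \<le> r \<Longrightarrow> nrm y \<le> r \<Longrightarrow> nrm (x + y) \<le> r"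
  using nrm_add[of x y] by simp

lemma nrm_diff_le: "nrm x \<le> r \<Longrightarrow> nrm y \<le> r \<Longrightarrow> nrm (x - y) \<le> r"
  using nrm_add_le[of x r "- y"] by simp

lemma nrm_add_less: "nrm x < r \<Longrightarrow> nrm y < r \<Longrightarrow> nrm (x + y) < r"
  using nrm_add[of x y] by simp

lemma nrm_diff_less: "nrm x < r \<Longrightarrow> nrm y < r \<Longrightarrow> nrm (x - y) < r"
  using nrm_add_less[of x r "- y"] by simp

lemma nrm_p: "nrm (of_nat p) = 1 / real p"
proof -
  have "prime_elem (int p)" using prime_p by simp
  then have "padic_val p (of_int (int p) / of_int 1) = 1"
    using p_gt_1 by (subst val_quotient) auto
  then show ?thesis using p_gt_1 by (simp add: padic_abs_def power_int_minus divide_inverse)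
qed

lemma nrm_p_power: "nrm (of_nat p ^ k) = (1 / real p) ^ k"
  by (induction k) (simp_all add: nrm_mult nrm_p)

text \<open>The valuation of \<open>p a\<^sup>2\<close> is odd and that of a square is even.\<close>

lemma nrm_square_neq:
  assumes "a \<noteq> 0" "c \<noteq> 0"
  shows "nrm (c * c) \<noteq> nrm (of_nat p * (a * a))"
proof
  assume eq: "nrm (c * c) = nrm (of_nat p * (a * a))"
  have "prime_elem (int p)" using prime_p by simp
  then have "padic_val p (of_int (int p) / of_int 1) = 1"
    using p_gt_1 by (subst val_quotient) auto
  moreover have "(of_nat p :: rat) \<noteq> 0" using p_gt_1 by simp
  ultimately have "padic_val p (of_nat p * (a * a)) = 1 + 2 * padic_val p a"
    using assms by (simp add: val_mult)
  moreover have "padic_val p (c * c) = 2 * padic_val p c" using assms by (simp add: val_mult)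
  moreover have "padic_val p (c * c) = padic_val p (of_nat p * (a * a))"
    using eq assms \<open>of_nat p \<noteq> 0\<close> p_gt_1
      power_int_strict_increasing[of "- padic_val p (c * c)" "- padic_val p (of_nat p * (a * a))" "real p"]
      power_int_strict_increasing[of "- padic_val p (of_nat p * (a * a))" "- padic_val p (c * c)" "real p"]
    by (auto simp: padic_abs_def intro: linorder_cases)
  ultimately show False by presburger
qed

text \<open>The nonzero values of the norm are integral powers of \<open>p\<close>, and
  \<open>p\<close> is the least one above \<open>1\<close>.\<close>

lemma nrm_gt_1:
  assumes "nrm a > 1"
  shows "nrm a \<ge> real p"
proof -
  have nz: "a \<noteq> 0" using assms by auto
  have "padic_val p a < 0"
  proof (rule ccontr)
    assume "\<not> padic_val p a < 0"
    then have "real p powi (- padic_val p a) \<le> real p powi 0"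
      using p_gt_1 by (intro power_int_increasing) auto
    then show False using assms nz by (simp add: padic_abs_def)
  qed
  then have "real p powi 1 \<le> real p powi (- padic_val p a)"
    using p_gt_1 by (intro power_int_increasing) auto
  then show ?thesis using nz by (simp add: padic_abs_def)
qed

text \<open>If \<open>nrm a > 1\<close>, then \<open>p a^2\<close> has norm above \<open>1\<close>
  and must be balanced by \<open>c^2 + c\<close>. This forces \<open>nrm c > 1\<close>, so
  \<open>c^2\<close> dominates \<open>c\<close> and has the same norm as \<open>p a^2\<close>,
  against the parity of valuations.\<close>

lemma integral_of_quadratic:
  assumes "nrm (c * c + c - of_nat p * (a * a)) \<le> 1"
  shows "nrm a \<le> 1"
proof (rule ccontr)
  assume "\<not> nrm a \<le> 1"
  then have a1: "nrm a > 1" by simp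
  then have a: "nrm a \<ge> real p" by (rule nrm_gt_1)
  have "nrm a * (nrm a / real p) > 1 * 1"
    using a1 a p_gt_1 by (intro mult_less_le_imp_less) auto
  then have pa: "nrm (of_nat p * (a * a)) > 1" by (simp add: nrm_mult nrm_p)
  show False
  proof (cases "nrm c \<le> 1")
    case True
    then have "nrm (c * c) \<le> 1" by (simp add: nrm_mult mult_le_one)
    then have "nrm (c * c + c) \<le> 1" using True by (rule nrm_add_le)
    from nrm_diff_le[OF this assms] show False using pa by simp
  next
    case False
    then have cc: "nrm c < nrm (c * c)" by (simp add: nrm_mult)
    have "nrm (c * c + c - of_nat p * (a * a) - c) \<le> nrm c"
      using nrm_diff_le[of "c * c + c - of_nat p * (a * a)" "nrm c" c] assms False by simp
    then have diff: "nrm (c * c - of_nat p * (a * a)) \<le> nrm c" by (simp add: algebra_simps)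
    have "nrm (c * c - of_nat p * (a * a) + of_nat p * (a * a))
        \<le> max (nrm (c * c - of_nat p * (a * a))) (nrm (of_nat p * (a * a)))"
      by (rule nrm_add)
    with diff cc have 1: "nrm (c * c) \<le> nrm (of_nat p * (a * a))" by auto
    have "nrm (c * c - (c * c - of_nat p * (a * a))) \<le> nrm (c * c)"
      using nrm_diff_le[of "c * c" "nrm (c * c)" "c * c - of_nat p * (a * a)"] diff cc by simp
    then have "nrm (of_nat p * (a * a)) \<le> nrm (c * c)" by simp
    with 1 have "nrm (c * c) = nrm (of_nat p * (a * a))" by simp
    moreover have "a \<noteq> 0" "c \<noteq> 0" using a1 False by auto
    ultimately show False using nrm_square_neq by blast
  qed
qed

section \<open>Cauchy sequences and null sequences\<close>

lemma CauchyD: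
  "padic_Cauchy p a \<Longrightarrow> e > 0 \<Longrightarrow> \<exists>N. \<forall>m\<ge>N. \<forall>n\<ge>N. nrm (a m - a n) < e"
  unfolding padic_Cauchy_def by blast

lemma null_iff: "a \<in> padic_null p \<longleftrightarrow> (\<forall>e>0. \<exists>N. \<forall>n\<ge>N. nrm (a n) < e)"
  unfolding padic_null_def LIMSEQ_def by simp

lemma null_imp_Cauchy:
  assumes "a \<in> padic_null p"
  shows "padic_Cauchy p a"
  using assms unfolding null_iff padic_Cauchy_def by (meson nrm_diff_less)

lemma Cauchy_const: "padic_Cauchy p (\<lambda>_. c)"
  unfolding padic_Cauchy_def by simp

lemma Cauchy_add:
  assumes "padic_Cauchy p a" "padic_Cauchy p b"
  shows "padic_Cauchy p (\<lambda>n. a n + b n)"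
  unfolding padic_Cauchy_def
proof (intro allI impI)
  fix e :: real assume "e > 0"
  then obtain M N where "\<forall>m\<ge>M. \<forall>n\<ge>M. nrm (a m - a n) < e" "\<forall>m\<ge>N. \<forall>n\<ge>N. nrm (b m - b n) < e"
    using assms CauchyD by meson
  then have "nrm ((a m - a n) + (b m - b n)) < e" if "m \<ge> max M N" "n \<ge> max M N" for m n
    using that by (intro nrm_add_less) auto
  then show "\<exists>N. \<forall>m\<ge>N. \<forall>n\<ge>N. nrm (a m + b m - (a n + b n)) < e"
    by (intro exI[of _ "max M N"]) (simp add: algebra_simps)
qed

lemma Cauchy_uminus: "padic_Cauchy p a \<Longrightarrow> padic_Cauchy p (\<lambda>n. - a n)"
  unfolding padic_Cauchy_def by (simp add: nrm_minus_commute)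

lemma Cauchy_diff:
  "padic_Cauchy p a \<Longrightarrow> padic_Cauchy p b \<Longrightarrow> padic_Cauchy p (\<lambda>n. a n - b n)"
  using Cauchy_add[of a "\<lambda>n. - b n"] Cauchy_uminus[of b] by simp

lemma Cauchy_bounded:
  assumes "padic_Cauchy p a"
  obtains B where "B > 0" "\<And>n. nrm (a n) \<le> B"
proof -
  obtain N where N: "\<forall>m\<ge>N. \<forall>n\<ge>N. nrm (a m - a n) < 1"
    using CauchyD[OF assms, of 1] by auto
  define B where "B = 1 + (\<Sum>n\<le>N. nrm (a n))"
  have sum: "nrm (a n) \<le> (\<Sum>n\<le>N. nrm (a n))" if "n \<le> N" for n
    using that by (intro member_le_sum) auto
  have "nrm (a n) \<le> B" for n
  proof (cases "n \<le> N")
    case True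
    then show ?thesis using sum[OF True] by (simp add: B_def)
  next
    case False
    then have "nrm (a n - a N) < 1" using N by simp
    then have "nrm (a n - a N + a N) \<le> B"
      using sum[of N] sum_nonneg[of "{..N}" "\<lambda>n. nrm (a n)"]
      by (intro nrm_add_le) (simp_all add: B_def)
    then show ?thesis by simp
  qed
  moreover have "B > 0" unfolding B_def by (intro add_pos_nonneg sum_nonneg) auto
  ultimately show ?thesis using that by blast
qed

lemma null_mult_bounded:
  assumes "a \<in> padic_null p" "\<And>n. nrm (b n) \<le> B"
  shows "(\<lambda>n. a n * b n) \<in> padic_null p"
  unfolding null_iff
proof (intro allI impI)
  fix e :: real assume "e > 0"
  have "B \<ge> 0" using assms(2)[of 0] nrm_nonneg[of "b 0"] by linarith
  \<comment> \<open>\<open>B\<close> may be \<open>0\<close>, so the division is by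
    \<open>B + 1\<close>.\<close>
  then obtain N where N: "\<forall>n\<ge>N. nrm (a n) < e / (B + 1)"
    using assms(1) \<open>e > 0\<close> unfolding null_iff by (meson add_nonneg_pos divide_pos_pos zero_less_one)
  have "nrm (a n * b n) < e" if "n \<ge> N" for n
  proof -
    have "nrm (a n * b n) \<le> nrm (a n) * (B + 1)"
      unfolding nrm_mult using assms(2)[of n] by (intro mult_left_mono) auto
    also have "\<dots> < e" using N that \<open>B \<ge> 0\<close> by (simp add: field_simps)
    finally show ?thesis .
  qed
  then show "\<exists>N. \<forall>n\<ge>N. nrm (a n * b n) < e" by blast
qed

lemma null_mult_Cauchy:
  assumes "a \<in> padic_null p" "padic_Cauchy p b"
  shows "(\<lambda>n. a n * b n) \<in> padic_null p"
  using Cauchy_bounded[OF assms(2)] null_mult_bounded[OF assms(1)] by metis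

lemma Cauchy_mult:
  assumes "padic_Cauchy p a" "padic_Cauchy p b"
  shows "padic_Cauchy p (\<lambda>n. a n * b n)"
  unfolding padic_Cauchy_def
proof (intro allI impI)
  fix e :: real assume "e > 0"
  obtain A where A: "A > 0" "\<And>n. nrm (a n) \<le> A" using Cauchy_bounded[OF assms(1)] by metis
  obtain B where B: "B > 0" "\<And>n. nrm (b n) \<le> B" using Cauchy_bounded[OF assms(2)] by metis
  obtain M where M: "\<forall>m\<ge>M. \<forall>n\<ge>M. nrm (a m - a n) < e / B"
    using CauchyD[OF assms(1), of "e / B"] B \<open>e > 0\<close> by auto
  obtain N where N: "\<forall>m\<ge>N. \<forall>n\<ge>N. nrm (b m - b n) < e / A"
    using CauchyD[OF assms(2), of "e / A"] A \<open>e > 0\<close> by auto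
  \<comment> \<open>The difference is split as \<open>(a m - a n) * b m + a n * (b m - b n)\<close>.
    By the ultrametric inequality each summand may use up the whole of \<open>e\<close>.\<close>
  have "nrm (a m * b m - a n * b n) < e" if mn: "m \<ge> max M N" "n \<ge> max M N" for m n
  proof -
    have "nrm (a m - a n) * nrm (b m) \<le> nrm (a m - a n) * B"
      using B by (intro mult_left_mono) auto
    also have "\<dots> < e" using M mn B by (simp add: field_simps)
    finally have 1: "nrm ((a m - a n) * b m) < e" by (simp add: nrm_mult)
    have "nrm (a n) * nrm (b m - b n) \<le> A * nrm (b m - b n)"
      using A by (intro mult_right_mono) auto
    also have "\<dots> < e" using N mn A by (simp add: field_simps)
    finally have 2: "nrm (a n * (b m - b n)) < e" by (simp add: nrm_mult)
    show ?thesis using nrm_add_less[OF 1 2] by (simp add: algebra_simps)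
  qed
  then show "\<exists>N. \<forall>m\<ge>N. \<forall>n\<ge>N. nrm (a m * b m - a n * b n) < e" by blast
qed

lemma null_add:
  assumes "a \<in> padic_null p" "b \<in> padic_null p"
  shows "(\<lambda>n. a n + b n) \<in> padic_null p"
  unfolding null_iff
proof (intro allI impI)
  fix e :: real assume "e > 0"
  then obtain M N where "\<forall>n\<ge>M. nrm (a n) < e" "\<forall>n\<ge>N. nrm (b n) < e"
    using assms unfolding null_iff by meson
  then show "\<exists>N. \<forall>n\<ge>N. nrm (a n + b n) < e"
    by (intro exI[of _ "max M N"]) (auto intro: nrm_add_less)
qed

text \<open>By the ultrametric inequality a telescoping sum is no larger than its largest term, so
  consecutive differences suffice.\<close>

lemma Cauchy_of_null_diff:
  assumes "(\<lambda>n. w (Suc n) - w n) \<in> padic_null p"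
  shows "padic_Cauchy p w"
  unfolding padic_Cauchy_def
proof (intro allI impI)
  fix e :: real assume "e > 0"
  then obtain N where N: "\<forall>n\<ge>N. nrm (w (Suc n) - w n) < e"
    using assms unfolding null_iff by blast
  have *: "nrm (w n - w N) < e" if "n \<ge> N" for n
    using that
  proof (induction n rule: dec_induct)
    case base
    then show ?case using \<open>e > 0\<close> by simp
  next
    case (step n)
    then have "nrm ((w (Suc n) - w n) + (w n - w N)) < e"
      using N by (intro nrm_add_less) auto
    then show ?case by simp
  qed
  have "nrm ((w m - w N) - (w n - w N)) < e" if "m \<ge> N" "n \<ge> N" for m n
    using nrm_diff_less[OF *[OF that(1)] *[OF that(2)]] by simp
  then show "\<exists>N. \<forall>m\<ge>N. \<forall>n\<ge>N. nrm (w m - w n) < e" by auto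
qed

text \<open>Hensel's lemma for \<open>w\<^sup>2 + w = p y\<^sup>2\<close>: the map \<open>w \<mapsto> p y\<^sup>2 - w\<^sup>2\<close> contracts \<open>p \<int>\<^sub>p\<close>.\<close>

lemma ex_quadratic_root:
  assumes y: "padic_Cauchy p y" and y1: "\<And>n. nrm (y n) \<le> 1"
  obtains w where "padic_Cauchy p w"
    "(\<lambda>n. w n * w n + w n - of_nat p * (y n * y n)) \<in> padic_null p"
proof -
  \<comment> \<open>Fixed-point iteration from \<open>0\<close> in which the parameter
    \<open>y n\<close> moves along with the iteration.\<close>
  define w where "w = rec_nat 0 (\<lambda>n x. of_nat p * (y n * y n) - x * x)"
  have w_Suc: "w (Suc n) = of_nat p * (y n * y n) - w n * w n" for n
    by (simp add: w_def)
  define q where "q = 1 / real p"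
  have q: "0 < q" "q < 1" using p_gt_1 by (auto simp: q_def)
  have wq: "nrm (w n) \<le> q" for n
  proof (induction n)
    case 0
    then show ?case using q by (simp add: w_def)
  next
    case (Suc n)
    have "nrm (w n) * nrm (w n) \<le> q * 1"
      using Suc q by (intro mult_mono) auto
    moreover have "q * (nrm (y n) * nrm (y n)) \<le> q * 1"
      using q y1 by (intro mult_left_mono mult_le_one) auto
    ultimately show ?case
      unfolding w_Suc by (intro nrm_diff_le) (auto simp: nrm_mult nrm_p q_def)
  qed
  have step: "nrm (w (Suc (Suc n)) - w (Suc n))
      \<le> max (nrm (y (Suc n) - y n)) (q * nrm (w (Suc n) - w n))" for n
  proof -
    \<comment> \<open>Factoring differences of squares: the change in \<open>y\<close> is multiplied
      by a factor of norm at most \<open>1\<close>, the previous change in \<open>w\<close> by one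
      of norm at most \<open>q\<close>.\<close>
    have eq: "w (Suc (Suc n)) - w (Suc n)
        = of_nat p * (y (Suc n) + y n) * (y (Suc n) - y n) - (w (Suc n) + w n) * (w (Suc n) - w n)"
      unfolding w_Suc[of "Suc n"] by (subst (3) w_Suc) (simp add: algebra_simps)
    have "nrm (of_nat p * (y (Suc n) + y n)) \<le> 1 * 1"
      unfolding nrm_mult using q y1 by (intro mult_mono nrm_add_le) (auto simp: nrm_p q_def)
    then have "nrm (of_nat p * (y (Suc n) + y n)) * nrm (y (Suc n) - y n) \<le> 1 * nrm (y (Suc n) - y n)"
      by (intro mult_right_mono) auto
    moreover have "nrm (w (Suc n) + w n) * nrm (w (Suc n) - w n) \<le> q * nrm (w (Suc n) - w n)"
      using wq by (intro mult_right_mono nrm_add_le) auto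
    ultimately show ?thesis
      unfolding eq by (intro nrm_diff_le) (auto simp: nrm_mult)
  qed
  have null: "(\<lambda>n. w (Suc n) - w n) \<in> padic_null p"
    unfolding null_iff
  proof (intro allI impI)
    fix r :: real assume "r > 0"
    define e where "e = r / 2"
    have "e > 0" using \<open>r > 0\<close> by (simp add: e_def)
    then obtain N where N: "\<forall>m\<ge>N. \<forall>n\<ge>N. nrm (y m - y n) < e" using CauchyD[OF y] by blast
    \<comment> \<open>From \<open>N\<close> on, \<open>e\<close> absorbs the changes in
      \<open>y\<close>, while the initial difference shrinks geometrically. The bound is not strict,
      hence the choice \<open>e = r / 2\<close>.\<close>
    have bound: "nrm (w (Suc (N + k)) - w (N + k)) \<le> max e (q ^ k * nrm (w (Suc N) - w N))" for k
    proof (induction k)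
      case 0
      then show ?case by simp
    next
      case (Suc k)
      have "q * nrm (w (Suc (N + k)) - w (N + k))
          \<le> q * max e (q ^ k * nrm (w (Suc N) - w N))"
        using Suc q by (intro mult_left_mono) auto
      also have "\<dots> = max (q * e) (q ^ Suc k * nrm (w (Suc N) - w N))"
        using q by (simp add: max_mult_distrib_left mult.assoc)
      also have "\<dots> \<le> max e (q ^ Suc k * nrm (w (Suc N) - w N))"
        using q \<open>e > 0\<close> by (intro max.mono) (auto simp: mult_le_cancel_right1)
      finally have "q * nrm (w (Suc (N + k)) - w (N + k)) \<le> \<dots>" .
      moreover have "nrm (y (Suc (N + k)) - y (N + k)) \<le> e"
        using N by (auto intro!: less_imp_le)
      ultimately show ?case using step[of "N + k"] by fastforce
    qed
    have "(\<lambda>k. q ^ k * nrm (w (Suc N) - w N)) \<longlonglongrightarrow> 0 * nrm (w (Suc N) - w N)"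
      using q by (intro tendsto_intros) auto
    then have "(\<lambda>k. q ^ k * nrm (w (Suc N) - w N)) \<longlonglongrightarrow> 0" by simp
    then have "\<forall>\<^sub>F k in sequentially. q ^ k * nrm (w (Suc N) - w N) < e"
      using \<open>e > 0\<close> by (rule order_tendstoD(2))
    then obtain K where "\<forall>k\<ge>K. q ^ k * nrm (w (Suc N) - w N) < e"
      unfolding eventually_sequentially by blast
    then have "nrm (w (Suc (N + k)) - w (N + k)) \<le> e" if "k \<ge> K" for k
      using bound[of k] that by fastforce
    then have "nrm (w (Suc n) - w n) < r" if "n \<ge> N + K" for n
      using that \<open>r > 0\<close> e_def by (metis add_leD1 add_le_cancel_left field_sum_of_halves
          le_add_diff_inverse less_add_same_cancel1 half_gt_zero order_le_less_trans)
    then show "\<exists>N. \<forall>n\<ge>N. nrm (w (Suc n) - w n) < r" by blast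
  qed
  show ?thesis
  proof (rule that)
    show "padic_Cauchy p w" using null by (rule Cauchy_of_null_diff)
    \<comment> \<open>By the recursion, the residual of the equation at \<open>w n\<close> is
      exactly \<open>w n - w (Suc n)\<close>.\<close>
    have "(\<lambda>n. (w (Suc n) - w n) * (-1)) \<in> padic_null p"
      using null by (intro null_mult_Cauchy Cauchy_const)
    then show "(\<lambda>n. w n * w n + w n - of_nat p * (y n * y n)) \<in> padic_null p"
      unfolding w_Suc by (simp add: algebra_simps)
  qed
qed

section \<open>The ring of Cauchy sequences and its ideal of null sequences\<close>

lemma cring_padic_Cauchy_ring: "cring (padic_Cauchy_ring p)"
proof (rule cringI)
  show "abelian_group (padic_Cauchy_ring p)"
  proof (rule abelian_groupI)
    fix x assume "x \<in> carrier (padic_Cauchy_ring p)"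
    then show "\<exists>y\<in>carrier (padic_Cauchy_ring p). y \<oplus>\<^bsub>padic_Cauchy_ring p\<^esub> x = \<zero>\<^bsub>padic_Cauchy_ring p\<^esub>"
      by (intro bexI[of _ "\<lambda>n. - x n"]) (auto simp: padic_Cauchy_ring_def Cauchy_uminus)
  qed (auto simp: padic_Cauchy_ring_def Cauchy_add Cauchy_const add_ac)
  show "Group.comm_monoid (padic_Cauchy_ring p)"
    by (rule comm_monoidI) (auto simp: padic_Cauchy_ring_def Cauchy_mult Cauchy_const mult_ac)
qed (auto simp: padic_Cauchy_ring_def algebra_simps)

lemma ideal_padic_null: "ideal (padic_null p) (padic_Cauchy_ring p)"
proof (rule idealI)
  interpret cring "padic_Cauchy_ring p" by (rule cring_padic_Cauchy_ring)
  show "ring (padic_Cauchy_ring p)" by (rule ring_axioms)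
  show "subgroup (padic_null p) (add_monoid (padic_Cauchy_ring p))"
  proof (rule group.subgroupI)
    show "Group.group (add_monoid (padic_Cauchy_ring p))" by (rule a_group)
    show "padic_null p \<noteq> {}" using null_iff[of "\<lambda>_. 0"] by auto
    fix a assume a: "a \<in> padic_null p"
    have "a \<in> carrier (padic_Cauchy_ring p)"
      using a by (simp add: padic_Cauchy_ring_def null_imp_Cauchy)
    then have "\<ominus>\<^bsub>padic_Cauchy_ring p\<^esub> a = (\<lambda>n. - a n)"
      using a by (intro minus_equality)
        (auto simp: padic_Cauchy_ring_def null_imp_Cauchy Cauchy_uminus)
    then show "inv\<^bsub>add_monoid (padic_Cauchy_ring p)\<^esub> a \<in> padic_null p"
      using a by (simp add: a_inv_def null_iff)
  qed (auto simp: padic_Cauchy_ring_def null_imp_Cauchy null_add)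
  fix a x assume ax: "a \<in> padic_null p" "x \<in> carrier (padic_Cauchy_ring p)"
  then have "(\<lambda>n. a n * x n) \<in> padic_null p"
    by (intro null_mult_Cauchy) (auto simp: padic_Cauchy_ring_def)
  then show "x \<otimes>\<^bsub>padic_Cauchy_ring p\<^esub> a \<in> padic_null p" "a \<otimes>\<^bsub>padic_Cauchy_ring p\<^esub> x \<in> padic_null p"
    by (auto simp: padic_Cauchy_ring_def mult.commute)
qed

end

section \<open>The field of \<open>p\<close>-adic numbers\<close>

text \<open>A field isomorphic to \<open>\<rat>\<^sub>p\<close> is described by the map \<open>L\<close> that sends a Cauchy sequence to its
  limit.\<close>

locale padic_field = padic +
  fixes L :: "(nat \<Rightarrow> rat) \<Rightarrow> 'k::field"
  assumes L_surj: "\<And>x. \<exists>a. padic_Cauchy p a \<and> L a = x"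
    and L_add: "\<And>a b. padic_Cauchy p a \<Longrightarrow> padic_Cauchy p b \<Longrightarrow> L (\<lambda>n. a n + b n) = L a + L b"
    and L_mult: "\<And>a b. padic_Cauchy p a \<Longrightarrow> padic_Cauchy p b \<Longrightarrow> L (\<lambda>n. a n * b n) = L a * L b"
    and L_1: "L (\<lambda>_. 1) = 1"
    and L_eq_0_iff: "\<And>a. padic_Cauchy p a \<Longrightarrow> L a = 0 \<longleftrightarrow> a \<in> padic_null p"
begin

lemma L_diff:
  assumes "padic_Cauchy p a" "padic_Cauchy p b"
  shows "L (\<lambda>n. a n - b n) = L a - L b"
  using L_add[OF Cauchy_diff[OF assms] assms(2)] by simp

lemma L_eq_iff:
  assumes "padic_Cauchy p a" "padic_Cauchy p b"
  shows "L a = L b \<longleftrightarrow> (\<lambda>n. a n - b n) \<in> padic_null p"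
  using L_eq_0_iff[OF Cauchy_diff[OF assms]] L_diff[OF assms] by simp

lemma unital_hom_L_const: "unital_hom (\<lambda>x. L (\<lambda>_. x))"
  using L_add[OF Cauchy_const Cauchy_const] L_mult[OF Cauchy_const Cauchy_const] L_1
  by (simp add: unital_hom_def)

text \<open>A constant sequence with nonzero value has constant positive norm and is not null; this
  covers \<open>p = 2\<close> as well.\<close>

lemma two_neq_0: "(2::'k) \<noteq> 0"
proof -
  have "L (\<lambda>_. of_nat 2) = of_nat 2" by (rule unital_hom_of_nat[OF unital_hom_L_const])
  moreover have "(\<lambda>_. of_nat 2) \<notin> padic_null p"
    unfolding null_iff by (auto intro!: exI[of _ "nrm 2"] simp: less_le)
  ultimately show ?thesis using L_eq_0_iff[OF Cauchy_const, of "of_nat 2"] by auto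
qed

text \<open>The ring of \<open>p\<close>-adic integers, defined by a condition that every ring endomorphism
  preserves.\<close>

definition integral :: "'k \<Rightarrow> bool" where
  "integral x \<longleftrightarrow> (\<exists>w. w * w + w = of_nat p * (x * x))"

lemma L_quadratic:
  assumes "padic_Cauchy p w" "padic_Cauchy p y"
  shows "L w * L w + L w = of_nat p * (L y * L y)
    \<longleftrightarrow> (\<lambda>n. w n * w n + w n - of_nat p * (y n * y n)) \<in> padic_null p"
proof -
  have "L (\<lambda>n. w n * w n + w n) = L w * L w + L w"
    using assms by (simp add: L_add L_mult Cauchy_mult)
  moreover have "L (\<lambda>n. of_nat p * (y n * y n)) = of_nat p * (L y * L y)"
    using assms unital_hom_of_nat[OF unital_hom_L_const, of p]
    by (simp add: L_mult Cauchy_mult Cauchy_const)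
  ultimately show ?thesis
    using L_eq_iff[of "\<lambda>n. w n * w n + w n" "\<lambda>n. of_nat p * (y n * y n)"] assms
    by (simp add: Cauchy_add Cauchy_mult Cauchy_const)
qed

text \<open>The limit of the sequence of approximate roots from \<open>ex_quadratic_root\<close> is
  the required witness.\<close>

lemma integralI:
  assumes "padic_Cauchy p y" "\<And>n. nrm (y n) \<le> 1"
  shows "integral (L y)"
  using ex_quadratic_root[OF assms] L_quadratic[OF _ assms(1)] unfolding integral_def by metis

text \<open>The residual of the equation is a null sequence, so its norm is eventually below
  \<open>1\<close> and \<open>integral_of_quadratic\<close> applies term by term. Early terms of
  \<open>y\<close> are unconstrained by the limit.\<close>

lemma integralD:
  assumes "padic_Cauchy p y" "integral (L y)"
  shows "\<exists>N. \<forall>n\<ge>N. nrm (y n) \<le> 1"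
proof -
  obtain w where "padic_Cauchy p w" "L w * L w + L w = of_nat p * (L y * L y)"
    using assms L_surj unfolding integral_def by metis
  then have "(\<lambda>n. w n * w n + w n - of_nat p * (y n * y n)) \<in> padic_null p"
    using L_quadratic assms(1) by blast
  then obtain N where N: "\<forall>n\<ge>N. nrm (w n * w n + w n - of_nat p * (y n * y n)) < 1"
    unfolding null_iff using zero_less_one by blast
  show ?thesis
  proof (intro exI[of _ N] allI impI)
    fix n assume "n \<ge> N"
    with N have "nrm (w n * w n + w n - of_nat p * (y n * y n)) < 1" by simp
    then show "nrm (y n) \<le> 1" using integral_of_quadratic[of "w n" "y n"] by simp
  qed
qed

text \<open>Dropping initial terms makes an eventual bound hold from the start, as
  \<open>integralI\<close> demands.\<close>

lemma L_shift:
  assumes "padic_Cauchy p a"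
  shows "padic_Cauchy p (\<lambda>n. a (N + n))" "L (\<lambda>n. a (N + n)) = L a"
proof -
  show *: "padic_Cauchy p (\<lambda>n. a (N + n))"
    unfolding padic_Cauchy_def
  proof (intro allI impI)
    fix e :: real assume "e > 0"
    then obtain M where "\<forall>m\<ge>M. \<forall>n\<ge>M. nrm (a m - a n) < e" using CauchyD[OF assms] by blast
    then show "\<exists>M. \<forall>m\<ge>M. \<forall>n\<ge>M. nrm (a (N + m) - a (N + n)) < e"
      by (intro exI[of _ M]) auto
  qed
  have "(\<lambda>n. a (N + n) - a n) \<in> padic_null p"
    unfolding null_iff
  proof (intro allI impI)
    fix e :: real assume "e > 0"
    then obtain M where "\<forall>m\<ge>M. \<forall>n\<ge>M. nrm (a m - a n) < e" using CauchyD[OF assms] by blast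
    then show "\<exists>M. \<forall>n\<ge>M. nrm (a (N + n) - a n) < e"
      by (intro exI[of _ M]) auto
  qed
  then show "L (\<lambda>n. a (N + n)) = L a" using L_eq_iff[OF * assms] by blast
qed

lemma rigid: "rigid TYPE('k)"
  unfolding rigid_def
proof (intro allI impI)
  fix \<sigma> :: "'k \<Rightarrow> 'k" and x
  assume \<sigma>: "unital_hom \<sigma>"
  have const: "\<sigma> (L (\<lambda>_. q)) = L (\<lambda>_. q)" for q
    using unital_hom_rat_unique[OF unital_hom_comp[OF \<sigma> unital_hom_L_const] unital_hom_L_const]
    by (metis comp_apply)
  have integral: "integral (\<sigma> y)" if "integral y" for y
  proof -
    obtain w where "w * w + w = of_nat p * (y * y)" using \<open>integral y\<close> unfolding integral_def by blast
    then have "\<sigma> (w * w + w) = \<sigma> (of_nat p * (y * y))" by simp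
    then have "\<sigma> w * \<sigma> w + \<sigma> w = of_nat p * (\<sigma> y * \<sigma> y)"
      by (simp add: unital_homD(2,3)[OF \<sigma>] unital_hom_of_nat[OF \<sigma>])
    then show ?thesis unfolding integral_def by blast
  qed
  obtain a where a: "padic_Cauchy p a" "L a = x" using L_surj by blast
  obtain b where b: "padic_Cauchy p b" "L b = \<sigma> x" using L_surj by blast
  \<comment> \<open>Continuity of \<open>\<sigma>\<close>: a rational close to \<open>x\<close> is
    shown to be equally close to \<open>\<sigma> x\<close>.\<close>
  have "(\<lambda>n. b n - a n) \<in> padic_null p"
    unfolding null_iff
  proof (intro allI impI)
    fix e :: real assume "e > 0"
    then obtain k where k: "(1 / real p) ^ k < e"
      using real_arch_pow_inv[of e "1 / real p"] p_gt_1 by auto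
    define r where "r = (1 / real p) ^ k"
    have r: "0 < r" "r < e" using k p_gt_1 by (auto simp: r_def)
    \<comment> \<open>Multiplication by \<open>u\<close>, of norm \<open>1 / r\<close>, turns a
      distance of at most \<open>r\<close> into integrality, which \<open>\<sigma>\<close>
      preserves.\<close>
    define u :: rat where "u = 1 / of_nat p ^ k"
    have "of_nat p ^ k * u = 1" using p_gt_1 by (simp add: u_def)
    then have "r * nrm u = 1" using nrm_mult[of "of_nat p ^ k" u] by (simp add: nrm_p_power r_def)
    then have "nrm u = 1 / r" using r by (simp add: field_simps)
    then have nrm_u: "nrm (c * u) \<le> 1 \<longleftrightarrow> nrm c \<le> r" for c
      using r by (simp add: nrm_mult)
    obtain N where N: "\<forall>m\<ge>N. \<forall>n\<ge>N. nrm (a m - a n) < r" using CauchyD[OF a(1) r(1)] by blast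
    have "nrm ((a (N + n) - a N) * u) \<le> 1" for n
      unfolding nrm_u using N by (simp add: less_imp_le)
    then have "integral (L (\<lambda>n. (a (N + n) - a N) * u))"
      by (intro integralI Cauchy_mult Cauchy_diff Cauchy_const L_shift(1) a(1))
    also have "L (\<lambda>n. (a (N + n) - a N) * u) = (x - L (\<lambda>_. a N)) * L (\<lambda>_. u)"
      using a by (simp add: L_mult L_diff L_shift Cauchy_diff Cauchy_const)
    finally have "integral (\<sigma> ((x - L (\<lambda>_. a N)) * L (\<lambda>_. u)))" by (rule integral)
    \<comment> \<open>The rational constants \<open>a N\<close> and \<open>u\<close> are fixed, so
      only \<open>x\<close> is replaced by \<open>\<sigma> x\<close>.\<close>
    also have "\<sigma> ((x - L (\<lambda>_. a N)) * L (\<lambda>_. u)) = L (\<lambda>n. (b n - a N) * u)"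
      using b by (simp add: unital_homD(3)[OF \<sigma>] unital_hom_diff[OF \<sigma>] const
          L_mult L_diff Cauchy_diff Cauchy_const)
    finally have int: "integral (L (\<lambda>n. (b n - a N) * u))" .
    have "padic_Cauchy p (\<lambda>n. (b n - a N) * u)"
      by (intro Cauchy_mult Cauchy_diff Cauchy_const b(1))
    from integralD[OF this int] obtain M where M: "\<forall>n\<ge>M. nrm ((b n - a N) * u) \<le> 1" by blast
    have "nrm (b n - a n) < e" if "n \<ge> max M N" for n
    proof -
      have "nrm (b n - a N) \<le> r" using M that unfolding nrm_u by simp
      moreover have "nrm (a N - a n) \<le> r" using N that by (simp add: less_imp_le)
      ultimately have "nrm ((b n - a N) + (a N - a n)) \<le> r" by (rule nrm_add_le)
      then show ?thesis using r by simp
    qed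
    then show "\<exists>N. \<forall>n\<ge>N. nrm (b n - a n) < e" by blast
  qed
  then show "\<sigma> x = x" using L_eq_iff[OF b(1) a(1)] a b by simp
qed

end

text \<open>The limit map is the projection onto cosets of null sequences followed by the inverse of
  the given isomorphism; its kernel is the ideal of null sequences.\<close>

lemma iso_Qp_imp_padic_field:
  assumes p: "Factorial_Ring.prime p"
    and iso: "(ring_of_type_algebra :: 'k::field ring) \<simeq> Qp p"
  shows "\<exists>L :: (nat \<Rightarrow> rat) \<Rightarrow> 'k. padic_field p L"
proof -
  interpret padic p by unfold_locales (rule p)
  interpret C: cring "padic_Cauchy_ring p" by (rule cring_padic_Cauchy_ring)
  interpret I: ideal "padic_null p" "padic_Cauchy_ring p" by (rule ideal_padic_null)
  let ?K = "ring_of_type_algebra :: 'k ring" and ?C = "padic_Cauchy_ring p"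
  let ?q = "\<lambda>a. padic_null p +>\<^bsub>?C\<^esub> a"
  have K: "ring ?K" by (rule ring_from_type_algebra)
  obtain h where h: "h \<in> ring_iso ?K (Qp p)"
    using iso unfolding is_ring_iso_def by blast
  define g where "g = inv_into (carrier ?K) h"
  have g: "g \<in> ring_iso (Qp p) ?K" unfolding g_def by (rule ring_iso_set_sym[OF K h])
  have q: "?q \<in> ring_hom ?C (Qp p)" unfolding Qp_def by (rule I.rcos_ring_hom)
  have "g \<circ> ?q \<in> ring_hom ?C ?K"
    using q g by (intro ring_hom_trans) (auto simp: ring_iso_def)
  note L = ring_hom_memE[OF this, unfolded ring_of_type_algebra_simps]
  have C: "carrier ?C = {a. padic_Cauchy p a}" by (simp add: padic_Cauchy_ring_def)
  have g_bij: "bij_betw g (carrier (Qp p)) UNIV"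
    using ring_iso_memE(5)[OF g] by (simp add: ring_of_type_algebra_simps)
  have carrier_Qp: "carrier (Qp p) = ?q ` carrier ?C"
    by (auto simp: Qp_def FactRing_def A_RCOSETS_def')
  have Q_0: "padic_null p = ?q (\<lambda>_. 0)"
    using C.a_coset_add_zero[OF I.a_subset] by (simp add: padic_Cauchy_ring_def)
  have "padic_field p (g \<circ> ?q)"
  proof unfold_locales
    fix x :: 'k
    show "\<exists>a. padic_Cauchy p a \<and> (g \<circ> ?q) a = x"
    proof -
      have "x \<in> g ` ?q ` {a. padic_Cauchy p a}"
        using g_bij unfolding carrier_Qp C bij_betw_def by simp
      then obtain a where "a \<in> {a. padic_Cauchy p a}" "x = g (?q a)" by blast
      then show ?thesis by (intro exI[of _ a]) simp
    qed
  next
    fix a b assume ab: "padic_Cauchy p a" "padic_Cauchy p b"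
    show "(g \<circ> ?q) (\<lambda>n. a n + b n) = (g \<circ> ?q) a + (g \<circ> ?q) b"
      using L(3)[of a b] ab unfolding C by (simp add: padic_Cauchy_ring_def)
    show "(g \<circ> ?q) (\<lambda>n. a n * b n) = (g \<circ> ?q) a * (g \<circ> ?q) b"
      using L(2)[of a b] ab unfolding C by (simp add: padic_Cauchy_ring_def)
  next
    show "(g \<circ> ?q) (\<lambda>_. 1) = 1"
      using L(4) by (simp add: padic_Cauchy_ring_def)
  next
    fix a assume a: "padic_Cauchy p a"
    have "(\<lambda>_. 0) \<oplus>\<^bsub>?C\<^esub> (\<lambda>_. 0) = (\<lambda>_. 0)" by (simp add: padic_Cauchy_ring_def)
    then have 0: "(g \<circ> ?q) (\<lambda>_. 0) = 0"
      using L(3)[of "\<lambda>_. 0" "\<lambda>_. 0"] Cauchy_const[of 0] unfolding C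
      by (metis add_cancel_right_right mem_Collect_eq)
    have "(g \<circ> ?q) a = 0 \<longleftrightarrow> (g \<circ> ?q) a = (g \<circ> ?q) (\<lambda>_. 0)" by (simp only: 0)
    also have "\<dots> \<longleftrightarrow> ?q a = ?q (\<lambda>_. 0)"
      using g_bij a Cauchy_const[of 0] unfolding carrier_Qp C
      by (auto simp: bij_betw_def inj_on_def)
    also have "\<dots> \<longleftrightarrow> a \<in> padic_null p"
      using a C.a_coset_join1[OF _ _ I.a_subgroup] C.a_coset_join2[OF _ I.a_subgroup]
      unfolding C Q_0[symmetric] by blast
    finally show "(g \<circ> ?q) a = 0 \<longleftrightarrow> a \<in> padic_null p" .
  qed
  then show ?thesis by blast
qed

section \<open>Line-preserving maps over admissible fields\<close>

text \<open>These two properties are all that the main argument takes from the list of fields: the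
  first lets diagonals of parallelograms meet, the second turns semilinear into linear.\<close>

lemma admissible_field_properties:
  assumes "admissible_field TYPE('k::field)"
  shows "(2::'k) \<noteq> 0 \<and> rigid TYPE('k)"
  using assms unfolding admissible_field_def
proof (elim disjE exE conjE)
  assume "(ring_of_type_algebra :: 'k ring) \<simeq> (ring_of_type_algebra :: real ring)"
  then obtain h :: "'k \<Rightarrow> real" where "unital_hom h" "bij h"
    using iso_type_algebra_imp_unital_hom by blast
  then show ?thesis using unital_hom_two_neq_0 rigid_transfer rigid_real by blast
next
  assume "(ring_of_type_algebra :: 'k ring) \<simeq> (ring_of_type_algebra :: rat ring)"
  then obtain h :: "'k \<Rightarrow> rat" where "unital_hom h" "bij h"
    using iso_type_algebra_imp_unital_hom by blast
  then show ?thesis using unital_hom_two_neq_0 rigid_transfer rigid_rat by blast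
next
  fix p :: nat
  assume "Factorial_Ring.prime p" "odd p" "(ring_of_type_algebra :: 'k ring) \<simeq> residue_ring (int p)"
  then show ?thesis using iso_residue_ring_rigid by blast
next
  fix p :: nat
  assume "Factorial_Ring.prime p" "(ring_of_type_algebra :: 'k ring) \<simeq> Qp p"
  then obtain L :: "(nat \<Rightarrow> rat) \<Rightarrow> 'k" where "padic_field p L"
    using iso_Qp_imp_padic_field by blast
  then show ?thesis using padic_field.two_neq_0 padic_field.rigid by blast
qed

theorem corollary1p9:
  fixes scaleV :: "'k::field \<Rightarrow> 'v::ab_group_add \<Rightarrow> 'v"
    and scaleW :: "'k \<Rightarrow> 'w::ab_group_add \<Rightarrow> 'w"
    and f :: "'v \<Rightarrow> 'w"
  assumes "admissible_field TYPE('k)"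
    and "vector_space scaleV" and "vector_space scaleW"
    and "dim_at_least 2 scaleV"
    and "\<And>l. affine_line scaleV l \<Longrightarrow> affine_line scaleW (f ` l)"
    and "\<And>l v. affine_line scaleV l \<Longrightarrow> v \<notin> l \<Longrightarrow> f v \<notin> f ` l"
  shows "affine_linear scaleV scaleW f"
proof -
  interpret V: vector_space scaleV by fact
  interpret W: vector_space scaleW by fact
  \<comment> \<open>Subtracting \<open>f 0\<close> keeps both hypotheses on lines and normalises the
    value at the origin.\<close>
  define g where "g v = f v - f 0" for v
  have g_image: "g ` l = (\<lambda>w. w - f 0) ` f ` l" for l
    by (simp add: g_def image_image)
  have translate: "affine_line scaleW ((\<lambda>w. w - f 0) ` l)" if line: "affine_line scaleW l" for l
  proof -
    obtain a w where w: "w \<noteq> 0" and l: "l = {a + scaleW c w |c. True}"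
      using line[unfolded affine_line_def] by (elim exE conjE)
    have eq: "a - f 0 + scaleW c w = a + scaleW c w - f 0" for c by simp
    have "(\<lambda>w. w - f 0) ` l = {(a - f 0) + scaleW c w |c. True}"
      unfolding l eq by blast
    then show ?thesis using w unfolding affine_line_def by blast
  qed
  interpret line_embedding scaleV scaleW g
  proof unfold_locales
    show "(2::'k) \<noteq> 0" using admissible_field_properties[OF assms(1)] by blast
    show "dim_at_least 2 scaleV" by fact
    show "g 0 = 0" by (simp add: g_def)
    fix l assume l: "affine_line scaleV l"
    show "affine_line scaleW (g ` l)" unfolding g_image by (intro translate assms(5) l)
    fix v assume "v \<notin> l"
    then have "f v \<notin> f ` l" by (rule assms(6)[OF l])
    then show "g v \<notin> g ` l" by (auto simp: g_def)
  qed
  obtain \<sigma> where \<sigma>: "unital_hom \<sigma>" "\<forall>c v. g (scaleV c v) = scaleW (\<sigma> c) (g v)"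
    "\<forall>u v. g (u + v) = g u + g v" using semilinear by blast
  \<comment> \<open>By rigidity the scalar map is the identity, so the semilinear map
    \<open>g\<close> is linear.\<close>
  have "\<sigma> c = c" for c
    using admissible_field_properties[OF assms(1)] \<sigma>(1) unfolding rigid_def by blast
  then have "Vector_Spaces.linear scaleV scaleW g"
    using \<sigma>(2,3) by unfold_locales simp_all
  moreover have "f = (\<lambda>w. w + f 0) \<circ> g" by (auto simp: g_def)
  ultimately show ?thesis unfolding affine_linear_def by blast
qed

end
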